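(* Let $(\sigma',u')$ and $(\sigma'',u'')$ be colored permutations. Then $$\mathbf G_{\sigma',u'}\,\mathbf G_{\sigma'',u''}=\sum_{\sigma\in\sigma'*\sigma''}\mathbf G_{\sigma,\,u'\cdot u''},$$ where $u'\cdot u''$ is the concatenation of the words $u'$ and $u''$. Therefore the dual free $l$-quasi-ribbons $\mathbf G_{\sigma,u}$, where $(\sigma,u)$ runs over all colored permutations, span a $\mathbb Z$-subalgebra of the free associative algebra $\mathbb Z\langle A\rangle$.
   Context: Fix an integer $l\ge1$, a set of colors $C=\{c_0,\dots,c_{l-1}\}$ with $l$ elements, and the infinite ordered alphabet $B=\{1<2<3<\cdots\}$. Let $A=B\times C$ be the $l$-colored alphabet. A word $w$ of length $n$ over $A$ is written as a pair $(v,u)$ with $v\in B^n$, $u\in C^n$. Since $A$ is infinite, elements of $\mathbb Z\langle A\rangle$ are here allowed to be infinite $\mathbb Z$-linear combinations of words of bounded length, with the usual concatenation product. The standardization $\mathrm{Std}(v)\in\mathfrak S_n$ of a word $v\in B^n$ is the permutation obtained by scanning $v$ from left to right and labelling $1,2,\dots$ the occurrences of its smallest letter, then continuing the numbering with the occurrences of the next smallest letter (again from left to right), and so on. The colored standardization of $w=(v,u)$ is $\mathbf{Std}(w)=(\mathrm{Std}(v),u)$. A colored permutation of size $n\ge 0$ is a pair $(\sigma,u)$ with $\sigma\in\mathfrak S_n$ and $u\in C^n$. The dual free $l$-quasi-ribbon is $$\mathbf G_{\sigma,u}=\sum_{w\in A^n;\ \mathbf{Std}(w)=(\sigma,u)}w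 .$$ The convolution $\sigma'*\sigma''$ of permutations $\sigma'\in\mathfrak S_p$ and $\sigma''\in\mathfrak S_q$ is the set of permutations $\tau\in\mathfrak S_{p+q}$ (written as words $\tau(1)\cdots\tau(p+q)$) such that the standardization of the first $p$ letters of $\tau$ is $\sigma'$ and the standardization of the last $q$ letters of $\tau$ is $\sigma''$. *)

theory Defs
  imports "HOL-Combinatorics.Multiset_Permutations"
begin

section \<open>The algebra of bounded-degree noncommutative series\<close>

text \<open>
  Elements of \<open>\<int>\<langle>A\<rangle>\<close> for a possibly infinite alphabet \<open>A\<close>: possibly infinite integral linear
  combinations of words whose lengths are bounded, represented by their coefficient functions.
\<close>

typedef 'a ncseries = "{f :: 'a list \<Rightarrow> int. \<exists>N. \<forall>w. f w \<noteq> 0 \<longrightarrow> length w \<le> N}"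
  morphisms coeff Abs_ncseries
  by (rule exI[of _ "\<lambda>_. 0"]) simp

setup_lifting type_definition_ncseries

lemma ncseries_eqI: "(\<And>w. coeff f w = coeff g w) \<Longrightarrow> f = g"
  by (simp add: coeff_inject[symmetric] fun_eq_iff)

instantiation ncseries :: (type) ring_1
begin

lift_definition zero_ncseries :: "'a ncseries" is "\<lambda>_. 0"
  by simp

lift_definition one_ncseries :: "'a ncseries" is "\<lambda>w. of_bool (w = [])"
  by (rule exI[of _ 0]) simp

lift_definition plus_ncseries :: "'a ncseries \<Rightarrow> 'a ncseries \<Rightarrow> 'a ncseries"
  is "\<lambda>f g w. f w + g w"
proof -
  fix f g :: "'a list \<Rightarrow> int"
  assume "\<exists>N. \<forall>w. f w \<noteq> 0 \<longrightarrow> length w \<le> N" "\<exists>N. \<forall>w. g w \<noteq> 0 \<longrightarrow> length w \<le> N"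
  then obtain M N where "\<forall>w. f w \<noteq> 0 \<longrightarrow> length w \<le> M" "\<forall>w. g w \<noteq> 0 \<longrightarrow> length w \<le> N"
    by blast
  then have "\<forall>w. f w + g w \<noteq> 0 \<longrightarrow> length w \<le> max M N"
    by (metis add_0 le_max_iff_disj)
  then show "\<exists>N. \<forall>w. f w + g w \<noteq> 0 \<longrightarrow> length w \<le> N" ..
qed

lift_definition uminus_ncseries :: "'a ncseries \<Rightarrow> 'a ncseries" is "\<lambda>f w. - f w"
  by simp

lift_definition minus_ncseries :: "'a ncseries \<Rightarrow> 'a ncseries \<Rightarrow> 'a ncseries"
  is "\<lambda>f g w. f w - g w"
proof -
  fix f g :: "'a list \<Rightarrow> int"
  assume "\<exists>N. \<forall>w. f w \<noteq> 0 \<longrightarrow> length w \<le> N" "\<exists>N. \<forall>w. g w \<noteq> 0 \<longrightarrow> length w \<le> N"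
  then obtain M N where "\<forall>w. f w \<noteq> 0 \<longrightarrow> length w \<le> M" "\<forall>w. g w \<noteq> 0 \<longrightarrow> length w \<le> N"
    by blast
  then have "\<forall>w. f w - g w \<noteq> 0 \<longrightarrow> length w \<le> max M N"
    by (metis diff_0_right le_max_iff_disj)
  then show "\<exists>N. \<forall>w. f w - g w \<noteq> 0 \<longrightarrow> length w \<le> N" ..
qed

text \<open>
  The bilinear extension of concatenation: the sum runs over all factorizations of \<open>w\<close> into a
  prefix and a suffix.
\<close>

lift_definition times_ncseries :: "'a ncseries \<Rightarrow> 'a ncseries \<Rightarrow> 'a ncseries"
  is "\<lambda>f g w. \<Sum>k\<le>length w. f (take k w) * g (drop k w)"
proof -
  fix f g :: "'a list \<Rightarrow> int"
  assume "\<exists>N. \<forall>w. f w \<noteq> 0 \<longrightarrow> length w \<le> N" "\<exists>N. \<forall>w. g w \<noteq> 0 \<longrightarrow> length w \<le> N"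
  then obtain M N where M: "\<And>w. f w \<noteq> 0 \<Longrightarrow> length w \<le> M" and N: "\<And>w. g w \<noteq> 0 \<Longrightarrow> length w \<le> N"
    by blast
  have "length w \<le> M + N" if "(\<Sum>k\<le>length w. f (take k w) * g (drop k w)) \<noteq> 0" for w
  proof -
    from that obtain k where k: "k \<le> length w" "f (take k w) * g (drop k w) \<noteq> 0"
      by (meson atMost_iff sum.neutral)
    then show ?thesis
      using M[of "take k w"] N[of "drop k w"] by simp
  qed
  then show "\<exists>N. \<forall>w. (\<Sum>k\<le>length w. f (take k w) * g (drop k w)) \<noteq> 0 \<longrightarrow> length w \<le> N"
    by blast
qed

instance
proof
  fix a b c :: "'a ncseries"
  show "a + b + c = a + (b + c)" "a + b = b + a" "0 + a = a" "- a + a = 0" "a - b = a + - b"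
    by (transfer, simp add: algebra_simps)+
  show "(a + b) * c = a * c + b * c" "a * (b + c) = a * b + a * c"
    by (transfer, simp add: algebra_simps sum.distrib)+
  show "(0 :: 'a ncseries) \<noteq> 1"
    by transfer (auto simp: fun_eq_iff)
  show "1 * a = a"
  proof (rule ncseries_eqI)
    fix w
    have "coeff (1 * a) w = (\<Sum>k\<le>length w. of_bool (take k w = []) * coeff a (drop k w))"
      by (simp add: times_ncseries.rep_eq one_ncseries.rep_eq)
    also have "\<dots> = (\<Sum>k\<in>{0}. of_bool (take k w = []) * coeff a (drop k w))"
      by (rule sum.mono_neutral_right) auto
    finally show "coeff (1 * a) w = coeff a w"
      by simp
  qed
  show "a * 1 = a"
  proof (rule ncseries_eqI)
    fix w
    have "coeff (a * 1) w = (\<Sum>k\<le>length w. coeff a (take k w) * of_bool (drop k w = []))"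
      by (simp add: times_ncseries.rep_eq one_ncseries.rep_eq)
    also have "\<dots> = (\<Sum>k\<in>{length w}. coeff a (take k w) * of_bool (drop k w = []))"
      by (rule sum.mono_neutral_right) auto
    finally show "coeff (a * 1) w = coeff a w"
      by simp
  qed
  show "a * b * c = a * (b * c)"
  proof (rule ncseries_eqI)
    fix w
    let ?t = "\<lambda>j k. coeff a (take j w) * coeff b (drop j (take k w)) * coeff c (drop k w)"
    have "coeff (a * b * c) w = (\<Sum>k\<le>length w. \<Sum>j\<le>k. ?t j k)"
      by (auto simp: times_ncseries.rep_eq sum_distrib_right min.absorb1 min.absorb2 intro!: sum.cong)
    also have "\<dots> = (\<Sum>(k, j)\<in>Sigma {..length w} (\<lambda>k. {..k}). ?t j k)"
      by (simp add: sum.Sigma)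
    also have "\<dots> = (\<Sum>(j, i)\<in>Sigma {..length w} (\<lambda>j. {..length w - j}). ?t j (j + i))"
      by (rule sum.reindex_bij_witness[where i = "\<lambda>(j, i). (j + i, j)" and j = "\<lambda>(k, j). (j, k - j)"])
        auto
    also have "\<dots> = (\<Sum>j\<le>length w. \<Sum>i\<le>length w - j. ?t j (j + i))"
      by (simp add: sum.Sigma)
    also have "\<dots> = coeff (a * (b * c)) w"
      by (simp add: times_ncseries.rep_eq sum_distrib_left take_drop add.commute mult.assoc)
    finally show "coeff (a * b * c) w = coeff (a * (b * c)) w" .
  qed
qed

end


section \<open>Integral spans and subalgebras\<close>

lemma module_of_int_mult: "module (\<lambda>k (x :: 'a :: ring_1). of_int k * x)"
  by unfold_locales (simp_all add: algebra_simps)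

definition int_span :: "'a :: ring_1 set \<Rightarrow> 'a set" where
  "int_span = module.span (\<lambda>k x. of_int k * x)"

text \<open>Subalgebras are unital.\<close>

definition int_subalgebra :: "'a :: ring_1 set \<Rightarrow> bool" where
  "int_subalgebra S \<longleftrightarrow>
     module.subspace (\<lambda>k x. of_int k * x) S \<and> 1 \<in> S \<and> (\<forall>x\<in>S. \<forall>y\<in>S. x * y \<in> S)"


section \<open>Standardization and convolution\<close>

text \<open>
  The (0-based) positions of \<open>v\<close> in the order in which standardization visits them: letters in
  increasing order, and the occurrences of each letter from left to right.
\<close>

definition scan_order :: "'b :: linorder list \<Rightarrow> nat list" where
  "scan_order v =
     concat (map (\<lambda>b. filter (\<lambda>i. v ! i = b) [0..<length v]) (sorted_list_of_set (set v)))"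

text \<open>
  Position \<open>i\<close> receives as label its 1-based index in the scanning order. Permutations of size
  \<open>n\<close> are written as words, i.e. as elements of \<open>permutations_of_set {1..n}\<close>.
\<close>

definition Std :: "'b :: linorder list \<Rightarrow> nat list" where
  "Std v = map (\<lambda>i. Suc (length (takeWhile (\<lambda>j. j \<noteq> i) (scan_order v)))) [0..<length v]"

definition convolution :: "nat list \<Rightarrow> nat list \<Rightarrow> nat list set" where
  "convolution \<sigma>' \<sigma>'' =
     {\<tau> \<in> permutations_of_set {1..length \<sigma>' + length \<sigma>''}.
        Std (take (length \<sigma>') \<tau>) = \<sigma>' \<and> Std (drop (length \<sigma>') \<tau>) = \<sigma>''}"


section \<open>Dual free quasi-ribbons\<close>

text \<open>
  The type \<open>num\<close> of positive binary numerals is the ordered alphabet \<open>{1 < 2 < 3 < \<dots>}\<close>; the set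
  of colors is a finite type \<open>'c\<close>, so the number of colors is \<open>CARD('c) \<ge> 1\<close>. A pair of words
  \<open>(v, u)\<close> of equal length is identified with the word \<open>zip v u\<close> of pairs.
\<close>

type_synonym 'c letter = "num \<times> 'c"

definition colored_Std :: "'c letter list \<Rightarrow> nat list \<times> 'c list" where
  "colored_Std w = (Std (map fst w), map snd w)"

definition colored_permutations :: "(nat list \<times> 'c list) set" where
  "colored_permutations = {(\<sigma>, u). \<sigma> \<in> permutations_of_set {1..length u}}"

text \<open>The formal sum of all words \<open>w\<close> whose colored standardization is \<open>(\<sigma>, u)\<close>.\<close>

lift_definition dual_quasi_ribbon :: "nat list \<Rightarrow> 'c list \<Rightarrow> 'c letter ncseries" ("\<^bold>G")
  is "\<lambda>\<sigma> u w. of_bool (colored_Std w = (\<sigma>, u))"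
proof -
  fix \<sigma> :: "nat list" and u :: "'c list"
  have "\<forall>w :: 'c letter list. (of_bool (colored_Std w = (\<sigma>, u)) :: int) \<noteq> 0 \<longrightarrow> length w \<le> length u"
    by (auto simp: colored_Std_def)
  then show "\<exists>N. \<forall>w :: 'c letter list. (of_bool (colored_Std w = (\<sigma>, u)) :: int) \<noteq> 0 \<longrightarrow> length w \<le> N" ..
qed

end

theory Submission
  imports Defs
begin

text \<open>
  The standardization of a word records exactly the total order in which its positions are visited,
  by letter and then from left to right. Restricting this order to a prefix or a suffix commutes
  with standardizing, so the prefix and suffix of \<open>v\<close> standardize to \<open>\<sigma>'\<close> and \<open>\<sigma>''\<close> iff those of
  \<open>Std v\<close> do, i.e. iff \<open>Std v\<close> lies in the convolution. The coefficients of both sides of the product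
  formula therefore agree, each word having only one factorization with a prefix of the right length.
\<close>

section \<open>Standardization as ranking of positions\<close>

text \<open>Lexicographic order on pairs (letter, position): the position breaks ties, so this is a
  strict total order even when letters repeat.\<close>

definition visited_before :: "'b :: linorder list \<Rightarrow> nat \<Rightarrow> nat \<Rightarrow> bool" where
  "visited_before v j i \<longleftrightarrow> v ! j < v ! i \<or> v ! j = v ! i \<and> j < i"

lemma visited_before_asym: "visited_before v j i \<Longrightarrow> \<not> visited_before v i j"
  by (auto simp: visited_before_def)

lemma visited_before_trans:
  "visited_before v i j \<Longrightarrow> visited_before v j k \<Longrightarrow> visited_before v i k"
  by (auto simp: visited_before_def)

lemma visited_before_total: "i \<noteq> j \<Longrightarrow> visited_before v i j \<or> visited_before v j i"
  by (auto simp: visited_before_def)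

text \<open>Asymmetry excludes repetitions and puts exactly the \<open>R\<close>-predecessors of
  \<open>i\<close> in front of it. This turns the index used in \<open>Std\<close> into a number of
  predecessors.\<close>

lemma length_takeWhile_sorted_wrt:
  assumes "sorted_wrt R xs" "i \<in> set xs" and asym: "\<And>x y. R x y \<Longrightarrow> \<not> R y x"
  shows "length (takeWhile (\<lambda>j. j \<noteq> i) xs) = card {j \<in> set xs. R j i}"
proof -
  obtain ys zs where xs: "xs = ys @ i # zs" "i \<notin> set ys"
    using split_list_first[OF assms(2)] by blast
  have irrefl: "\<not> R x x" for x
    using asym by blast
  have "sorted_wrt R ys"
    using assms(1) xs by (simp add: sorted_wrt_append)
  then have "distinct ys"
    using irrefl by (induction ys) auto
  moreover have "{j \<in> set xs. R j i} = set ys"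
    using assms(1) xs asym irrefl by (auto simp: sorted_wrt_append)
  moreover have "takeWhile (\<lambda>j. j \<noteq> i) xs = ys"
    unfolding xs using xs(2) by (subst takeWhile_append2) auto
  ultimately show ?thesis
    by (simp add: distinct_card)
qed

lemma set_scan_order: "set (scan_order v) = {..<length v}"
  by (auto simp: scan_order_def)

text \<open>Positions increase inside the block of one letter, and letters increase strictly from
  block to block.\<close>

lemma sorted_wrt_scan_order: "sorted_wrt (visited_before v) (scan_order v)"
proof -
  have "sorted_wrt (visited_before v) (concat (map (\<lambda>b. filter (\<lambda>i. v ! i = b) [0..<length v]) bs))"
    if "sorted_wrt (<) bs" for bs
    using that
  proof (induction bs)
    case (Cons b bs)
    have "sorted_wrt (<) (filter (\<lambda>i. v ! i = b) [0..<length v])"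
      by (intro sorted_wrt_filter sorted_wrt_upt)
    then have "sorted_wrt (visited_before v) (filter (\<lambda>i. v ! i = b) [0..<length v])"
      by (rule sorted_wrt_mono_rel[rotated]) (auto simp: visited_before_def)
    moreover have "visited_before v i j" if "v ! i = b" "v ! j \<in> set bs" for i j
      using that Cons.prems by (auto simp: visited_before_def)
    ultimately show ?case
      using Cons by (auto simp: sorted_wrt_append)
  qed simp
  then show ?thesis
    by (simp add: scan_order_def)
qed

lemma length_Std [simp]: "length (Std v) = length v"
  by (simp add: Std_def)

lemma nth_Std:
  assumes "i < length v"
  shows "Std v ! i = Suc (card {j. j < length v \<and> visited_before v j i})"
  using assms length_takeWhile_sorted_wrt[OF sorted_wrt_scan_order _ visited_before_asym, of i v]
  by (simp add: Std_def set_scan_order lessThan_def)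

text \<open>Labels are ranks, so they depend on the order of positions alone. The two words may be
  over different alphabets, which allows comparing a word with its standardization.\<close>

lemma Std_cong:
  assumes "length v = length w"
    and "\<And>i j. i < length w \<Longrightarrow> j < length w \<Longrightarrow> visited_before v j i \<longleftrightarrow> visited_before w j i"
  shows "Std v = Std w"
proof (rule nth_equalityI)
  fix i assume "i < length (Std v)"
  then have "i < length w"
    using assms(1) by simp
  then have "{j. j < length v \<and> visited_before v j i} = {j. j < length w \<and> visited_before w j i}"
    using assms by auto
  with \<open>i < length w\<close> show "Std v ! i = Std w ! i"
    using assms(1) by (simp add: nth_Std)
qed (use assms in simp)

text \<open>By transitivity every predecessor of \<open>j\<close> precedes \<open>i\<close>; the
  inclusion is strict because \<open>j\<close> precedes \<open>i\<close> but not itself.\<close>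

lemma nth_Std_mono:
  assumes "i < length v" "j < length v" "visited_before v j i"
  shows "Std v ! j < Std v ! i"
proof -
  have "{k. k < length v \<and> visited_before v k j} \<subset> {k. k < length v \<and> visited_before v k i}"
    using assms visited_before_trans visited_before_asym by blast
  then show ?thesis
    using assms by (simp add: nth_Std psubset_card_mono)
qed

lemma nth_Std_less_iff:
  assumes "i < length v" "j < length v"
  shows "Std v ! j < Std v ! i \<longleftrightarrow> visited_before v j i"
  using assms nth_Std_mono visited_before_total by (metis less_asym less_irrefl)

lemma distinct_Std: "distinct (Std v)"
  unfolding distinct_conv_nth by (metis length_Std nth_Std_mono visited_before_total less_irrefl)

text \<open>No position precedes itself, so ranks are at most the length; being distinct, the labels
  fill the whole interval by counting.\<close>

lemma Std_permutation: "Std v \<in> permutations_of_set {1..length v}"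
proof -
  have "Std v ! i \<le> length v" if "i < length v" for i
  proof -
    have "{j. j < length v \<and> visited_before v j i} \<subset> {..<length v}"
      using that visited_before_asym by blast
    then show ?thesis
      using that psubset_card_mono[of "{..<length v}"] by (simp add: nth_Std Suc_le_eq)
  qed
  then have "set (Std v) \<subseteq> {1..length v}"
    by (auto simp: in_set_conv_nth nth_Std)
  moreover have "card (set (Std v)) = card {1..length v}"
    by (simp add: distinct_card distinct_Std)
  ultimately have "set (Std v) = {1..length v}"
    by (simp add: card_subset_eq)
  then show ?thesis
    by (simp add: permutations_of_set_def distinct_Std)
qed

text \<open>The letters of \<open>Std v\<close> are distinct, so the tie-breaking clause never
  applies and comparing labels decides the order.\<close>

lemma visited_before_Std:
  assumes "i < length v" "j < length v"
  shows "visited_before (Std v) j i \<longleftrightarrow> visited_before v j i"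
  using assms nth_Std_less_iff[of _ v] nth_eq_iff_index_eq[OF distinct_Std, of _ v]
  unfolding visited_before_def[of "Std v"] by auto

lemma Std_take_Std: "Std (take k (Std v)) = Std (take k v)"
proof (rule Std_cong)
  fix i j assume "i < length (take k v)" "j < length (take k v)"
  then show "visited_before (take k (Std v)) j i \<longleftrightarrow> visited_before (take k v) j i"
    using visited_before_Std[of i v j] by (simp add: visited_before_def)
qed simp

text \<open>Dropping shifts all positions by the same \<open>k\<close>, which leaves the
  tie-breaking comparison unchanged.\<close>

lemma Std_drop_Std: "Std (drop k (Std v)) = Std (drop k v)"
proof (rule Std_cong)
  fix i j assume "i < length (drop k v)" "j < length (drop k v)"
  then show "visited_before (drop k (Std v)) j i \<longleftrightarrow> visited_before (drop k v) j i"
    using visited_before_Std[of "k + i" v "k + j"] by (simp add: visited_before_def)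
qed simp

lemma Std_in_convolution_iff:
  assumes "length v = length \<sigma>' + length \<sigma>''"
  shows "Std v \<in> convolution \<sigma>' \<sigma>'' \<longleftrightarrow>
    Std (take (length \<sigma>') v) = \<sigma>' \<and> Std (drop (length \<sigma>') v) = \<sigma>''"
  using Std_permutation[of v] assms by (simp add: convolution_def Std_take_Std Std_drop_Std)

section \<open>The product formula\<close>

lemma finite_convolution: "finite (convolution \<sigma>' \<sigma>'')"
  by (simp add: convolution_def)

lemma coeff_sum: "coeff (\<Sum>x\<in>X. f x) w = (\<Sum>x\<in>X. coeff (f x) w)"
  by (induction X rule: infinite_finite_induct) (simp_all add: zero_ncseries.rep_eq plus_ncseries.rep_eq)

lemma dual_quasi_ribbon_mult:
  assumes len: "length \<sigma>' = length u'" "length \<sigma>'' = length u''"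
  shows "\<^bold>G \<sigma>' u' * \<^bold>G \<sigma>'' u'' = (\<Sum>\<sigma>\<in>convolution \<sigma>' \<sigma>''. \<^bold>G \<sigma> (u' @ u''))"
proof (rule ncseries_eqI)
  fix w :: "'a letter list"
  let ?p = "length u'" and ?v = "map fst w" and ?u = "map snd w"
  let ?L = "\<lambda>k. colored_Std (take k w) = (\<sigma>', u') \<and> colored_Std (drop k w) = (\<sigma>'', u'')"
  \<comment> \<open>The colors determine the cut: only \<open>k = ?p\<close> can split
    \<open>w\<close> into factors with color words \<open>u'\<close> and \<open>u''\<close>.\<close>
  have L: "?L k \<longleftrightarrow> k = ?p \<and> Std ?v \<in> convolution \<sigma>' \<sigma>'' \<and> ?u = u' @ u''" if "k \<le> length w" for k
  proof (cases "k = ?p \<and> ?u = u' @ u''")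
    case True
    then have "length ?v = length \<sigma>' + length \<sigma>''"
      using len by (metis length_append length_map)
    with True show ?thesis
      by (simp add: colored_Std_def Std_in_convolution_iff len take_map[symmetric] drop_map[symmetric])
  next
    case False
    have "k = ?p \<and> ?u = u' @ u''" if "?L k"
    proof
      have "map snd (take k w) = u'" "map snd (drop k w) = u''"
        using that by (simp_all add: colored_Std_def)
      then show "k = ?p" "?u = u' @ u''"
        \<comment> \<open>The bound on \<open>k\<close> ensures that \<open>take k w\<close> really
          has length \<open>k\<close>.\<close>
        using \<open>k \<le> length w\<close> by (auto simp flip: map_append)
    qed
    with False show ?thesis
      by blast
  qed
  have "coeff (\<^bold>G \<sigma>' u' * \<^bold>G \<sigma>'' u'') w = (\<Sum>k\<le>length w. of_bool (?L k))"
    by (simp add: times_ncseries.rep_eq dual_quasi_ribbon.rep_eq of_bool_conj)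
  also have "\<dots> = (\<Sum>k\<le>length w. if k = ?p
      then of_bool (Std ?v \<in> convolution \<sigma>' \<sigma>'' \<and> ?u = u' @ u'') else 0)"
    using L by (intro sum.cong) auto
  also have "\<dots> = of_bool (?p \<le> length w \<and> Std ?v \<in> convolution \<sigma>' \<sigma>'' \<and> ?u = u' @ u'')"
    by (subst sum.delta) auto
  also have "\<dots> = of_bool (Std ?v \<in> convolution \<sigma>' \<sigma>'' \<and> ?u = u' @ u'')"
  proof -
    have "?p \<le> length w" if "?u = u' @ u''"
      using arg_cong[OF that, of length] by simp
    then show ?thesis
      by (auto simp: of_bool_def)
  qed
  \<comment> \<open>A single index, \<open>\<sigma> = Std ?v\<close>, can contribute, so the
    indicator of membership expands into a sum over the finite convolution.\<close>
  also have "\<dots> = (\<Sum>\<sigma>\<in>convolution \<sigma>' \<sigma>''. if Std ?v = \<sigma> then of_bool (?u = u' @ u'') else 0)"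
    by (simp add: finite_convolution of_bool_conj)
  also have "\<dots> = coeff (\<Sum>\<sigma>\<in>convolution \<sigma>' \<sigma>''. \<^bold>G \<sigma> (u' @ u'')) w"
    unfolding coeff_sum
    by (intro sum.cong) (auto simp: dual_quasi_ribbon.rep_eq colored_Std_def)
  finally show "coeff (\<^bold>G \<sigma>' u' * \<^bold>G \<sigma>'' u'') w = coeff (\<Sum>\<sigma>\<in>convolution \<sigma>' \<sigma>''. \<^bold>G \<sigma> (u' @ u'')) w" .
qed

lemma dual_quasi_ribbon_Nil: "\<^bold>G [] [] = 1"
  by (rule ncseries_eqI) (auto simp: dual_quasi_ribbon.rep_eq one_ncseries.rep_eq colored_Std_def Std_def)

section \<open>Integral spans closed under multiplication\<close>

text \<open>Bilinearity in two inductions: first a generator times an element of the span, then an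
  arbitrary element of the span as left factor.\<close>

lemma int_subalgebra_int_span:
  fixes X :: "'a :: ring_1 set"
  assumes one: "1 \<in> int_span X" and mult: "\<And>x y. x \<in> X \<Longrightarrow> y \<in> X \<Longrightarrow> x * y \<in> int_span X"
  shows "int_subalgebra (int_span X)"
proof -
  interpret module "\<lambda>k (x :: 'a). of_int k * x"
    by (rule module_of_int_mult)
  have span: "int_span X = span X"
    by (simp add: int_span_def)
  have left: "x * y \<in> span X" if "x \<in> X" "y \<in> span X" for x y
    using that(2)
  proof (induction rule: span_induct_alt)
    case base
    show ?case
      by (simp add: span_zero)
  next
    case (step c z y)
    \<comment> \<open>Integers are central in any ring, so the scalar can be moved past
      \<open>x\<close>.\<close>
    have "x * (of_int c * z + y) = of_int c * (x * z) + x * y"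
      by (metis distrib_left mult.assoc mult_of_int_commute)
    then show ?case
      using mult[OF that(1) step(1)] step(2) unfolding span by (metis span_add span_scale)
  qed
  have "x * y \<in> span X" if "x \<in> span X" "y \<in> span X" for x y
    using that(1)
  proof (induction rule: span_induct_alt)
    case base
    show ?case
      by (simp add: span_zero)
  next
    case (step c z x)
    have "(of_int c * z + x) * y = of_int c * (z * y) + x * y"
      by (simp add: distrib_right mult.assoc)
    then show ?case
      using left[OF step(1) that(2)] step(2) by (metis span_add span_scale)
  qed
  then show ?thesis
    using one by (simp add: int_subalgebra_def span subspace_span)
qed

theorem theorem2p2:
  "(\<forall>(\<sigma>' :: nat list, u' :: ('c :: finite) list) \<in> colored_permutations.
      \<forall>(\<sigma>'', u'') \<in> colored_permutations.
        \<^bold>G \<sigma>' u' * \<^bold>G \<sigma>'' u'' = (\<Sum>\<sigma> \<in> convolution \<sigma>' \<sigma>''. \<^bold>G \<sigma> (u' @ u'')))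
   \<and> int_subalgebra (int_span {\<^bold>G \<sigma> u | \<sigma> (u :: 'c list). (\<sigma>, u) \<in> colored_permutations})"
proof -
  let ?X = "{\<^bold>G \<sigma> u | \<sigma> (u :: 'c list). (\<sigma>, u) \<in> colored_permutations}"
  interpret module "\<lambda>k (x :: 'c letter ncseries). of_int k * x"
    by (rule module_of_int_mult)
  have len: "length \<sigma> = length u" if "(\<sigma>, u) \<in> colored_permutations" for \<sigma> and u :: "'c list"
    using that by (auto simp: colored_permutations_def dest: length_finite_permutations_of_set)
  \<comment> \<open>Makes every summand of the product formula a generator again, so products of
    generators stay in the span.\<close>
  have conv: "(\<sigma>, u' @ u'') \<in> colored_permutations"
    if "(\<sigma>', u') \<in> colored_permutations" "(\<sigma>'', u'') \<in> colored_permutations"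
      "\<sigma> \<in> convolution \<sigma>' \<sigma>''" for \<sigma> \<sigma>' \<sigma>'' and u' u'' :: "'c list"
    using that(3) len[OF that(1)] len[OF that(2)] by (simp add: colored_permutations_def convolution_def)
  have "int_subalgebra (int_span ?X)"
  proof (rule int_subalgebra_int_span)
    \<comment> \<open>The empty colored permutation supplies the unit.\<close>
    have "([], []) \<in> (colored_permutations :: (nat list \<times> 'c list) set)"
      by (simp add: colored_permutations_def)
    then have "1 \<in> ?X"
      using dual_quasi_ribbon_Nil by (metis (mono_tags, lifting) mem_Collect_eq)
    then show "1 \<in> int_span ?X"
      by (simp add: int_span_def span_base)
  next
    fix x y assume "x \<in> ?X" "y \<in> ?X"
    then obtain \<sigma>' u' \<sigma>'' u'' where *:
      "x = \<^bold>G \<sigma>' u'" "(\<sigma>', u') \<in> colored_permutations"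
      "y = \<^bold>G \<sigma>'' u''" "(\<sigma>'', u'') \<in> colored_permutations"
      by auto
    then have "x * y = (\<Sum>\<sigma>\<in>convolution \<sigma>' \<sigma>''. \<^bold>G \<sigma> (u' @ u''))"
      by (simp add: dual_quasi_ribbon_mult len)
    also have "\<dots> \<in> span ?X"
      using conv[OF *(2,4)] by (blast intro: span_sum span_base)
    finally show "x * y \<in> int_span ?X"
      by (simp add: int_span_def)
  qed
  then show ?thesis
    by (auto simp: dual_quasi_ribbon_mult len)
qed

end
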